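(* Suppose that $M$ is an infinite mutually algebraic $L$-structure and that $N_1,N_2\succeq M$ are elementary extensions of $M$. Then every component map $f:N_1\rightarrow N_2$ is an isomorphism (of $L$-structures). Conversely, every isomorphism $f:N_1\rightarrow N_2$ that is the identity on $M$ is a component map.
   Context: $L(M)$ is $L$ with a constant symbol for each element of $M$, and $M_M$ is the canonical expansion of $M$ to an $L(M)$-structure. For a set $A$ and $n\ge1$, a subset $B\subseteq A^n$ is mutually algebraic if there is an integer $K$ such that for every partition $X\sqcup Y=\{1,\dots,n\}$ into two nonempty disjoint sets, the projection $\pi_Y$ onto the coordinates in $Y$, restricted to $B$, is at most $K$-to-1. An $L(M)$-formula $\varphi(\bar z)$ (with displayed tuple of distinct variables, $\lg(\bar z)\ge1$) is mutually algebraic if its solution set $\varphi(M)$ is a mutually algebraic subset of $M^{\lg(\bar z)}$; $\mathcal{MA}(M)$ is the set of all such formulas. $\mathcal{MA}^*(M)$ is the set of all $L(M)$-formulas that are $Th(M_M)$-equivalent to a boolean combination of formulas from $\mathcal{MA}(M)$ (the formulas in the combination may use different subtuples of the free variables). $M$ is a mutually algebraic structure if every $L(M)$-formula is in $\mathcal{MA}^*(M)$. $\mathrm{acl}_M(B)$ abbreviates the model-theoretic algebraic closure $\mathrm{acl}(M\cup B)$, computed in a large saturated model $\mathfrak{C}\succeq M$ into which the elementary extensions of $M$ under consideration are elementarily embedded over $M$ (for $B\subseteq N$ with $M\preceq N\preceq\mathfrak{C}$ this equals the closure computed in $N$). Component map: for elementary extensions $N_1,N_2$ of $M$, a component map $f:N_1\to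 N_2$ is a bijection such that $f|_M=\mathrm{id}$ and for each $b\in N_1\setminus M$: (i) $f$ restricted to $\mathrm{acl}_M(\{b\})$ is elementary (a partial elementary map from $N_1$ to $N_2$), and (ii) $f(\mathrm{acl}_M(\{b\}))=\mathrm{acl}_M(\{f(b)\})$ setwise. *)

theory Defs
  imports Complex_Main
begin

text \<open>
  First-order logic with equality over an arbitrary language. A language selects its symbols from
  two types, so that it may have no function symbols or no relation symbols; constant symbols are
  function symbols of arity 0. Structures have a universe that is a set, so that several structures
  over one type can share elements, as elementary extensions of a common structure do.
\<close>

record ('f, 'r) language =
  Funs :: "'f set"
  Rels :: "'r set"
  funar :: "'f \<Rightarrow> nat"
  relar :: "'r \<Rightarrow> nat"

record ('f, 'r, 'a) struct =
  univ :: "'a set"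
  fint :: "'f \<Rightarrow> 'a list \<Rightarrow> 'a"
  rint :: "'r \<Rightarrow> 'a list \<Rightarrow> bool"

definition is_struct :: "('f, 'r) language \<Rightarrow> ('f, 'r, 'a) struct \<Rightarrow> bool" where
  "is_struct L S \<longleftrightarrow> univ S \<noteq> {} \<and>
     (\<forall>f\<in>Funs L. \<forall>as. length as = funar L f \<and> set as \<subseteq> univ S \<longrightarrow> fint S f as \<in> univ S)"

datatype 'f trm = Var nat | App 'f "'f trm list"

datatype ('f, 'r) fm =
    Eq "'f trm" "'f trm"
  | Rel 'r "'f trm list"
  | Neg "('f, 'r) fm"
  | Conj "('f, 'r) fm" "('f, 'r) fm"
  | Exists nat "('f, 'r) fm"

fun vars_trm :: "'f trm \<Rightarrow> nat set" where
  "vars_trm (Var x) = {x}"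
| "vars_trm (App f ts) = (\<Union>t\<in>set ts. vars_trm t)"

fun FV :: "('f, 'r) fm \<Rightarrow> nat set" where
  "FV (Eq s t) = vars_trm s \<union> vars_trm t"
| "FV (Rel r ts) = (\<Union>t\<in>set ts. vars_trm t)"
| "FV (Neg \<phi>) = FV \<phi>"
| "FV (Conj \<phi> \<psi>) = FV \<phi> \<union> FV \<psi>"
| "FV (Exists x \<phi>) = FV \<phi> - {x}"

fun wf_trm :: "('f, 'r) language \<Rightarrow> 'f trm \<Rightarrow> bool" where
  "wf_trm L (Var x) \<longleftrightarrow> True"
| "wf_trm L (App f ts) \<longleftrightarrow> f \<in> Funs L \<and> length ts = funar L f \<and> (\<forall>t\<in>set ts. wf_trm L t)"

fun wf_fm :: "('f, 'r) language \<Rightarrow> ('f, 'r) fm \<Rightarrow> bool" where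
  "wf_fm L (Eq s t) \<longleftrightarrow> wf_trm L s \<and> wf_trm L t"
| "wf_fm L (Rel r ts) \<longleftrightarrow> r \<in> Rels L \<and> length ts = relar L r \<and> (\<forall>t\<in>set ts. wf_trm L t)"
| "wf_fm L (Neg \<phi>) \<longleftrightarrow> wf_fm L \<phi>"
| "wf_fm L (Conj \<phi> \<psi>) \<longleftrightarrow> wf_fm L \<phi> \<and> wf_fm L \<psi>"
| "wf_fm L (Exists x \<phi>) \<longleftrightarrow> wf_fm L \<phi>"

definition formulas :: "('f, 'r) language \<Rightarrow> ('f, 'r) fm set" where
  "formulas L = {\<phi>. wf_fm L \<phi>}"

fun eval :: "('f, 'r, 'a) struct \<Rightarrow> (nat \<Rightarrow> 'a) \<Rightarrow> 'f trm \<Rightarrow> 'a" where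
  "eval S e (Var x) = e x"
| "eval S e (App f ts) = fint S f (map (eval S e) ts)"

fun sat :: "('f, 'r, 'a) struct \<Rightarrow> (nat \<Rightarrow> 'a) \<Rightarrow> ('f, 'r) fm \<Rightarrow> bool" where
  "sat S e (Eq s t) \<longleftrightarrow> eval S e s = eval S e t"
| "sat S e (Rel r ts) \<longleftrightarrow> rint S r (map (eval S e) ts)"
| "sat S e (Neg \<phi>) \<longleftrightarrow> \<not> sat S e \<phi>"
| "sat S e (Conj \<phi> \<psi>) \<longleftrightarrow> sat S e \<phi> \<and> sat S e \<psi>"
| "sat S e (Exists x \<phi>) \<longleftrightarrow> (\<exists>a\<in>univ S. sat S (e(x := a)) \<phi>)"

definition isomorphism ::
  "('f, 'r) language \<Rightarrow> ('f, 'r, 'a) struct \<Rightarrow> ('f, 'r, 'b) struct \<Rightarrow> ('a \<Rightarrow> 'b) \<Rightarrow> bool" where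
  "isomorphism L S T h \<longleftrightarrow>
     bij_betw h (univ S) (univ T) \<and>
     (\<forall>f\<in>Funs L. \<forall>as. length as = funar L f \<and> set as \<subseteq> univ S \<longrightarrow>
        h (fint S f as) = fint T f (map h as)) \<and>
     (\<forall>r\<in>Rels L. \<forall>as. length as = relar L r \<and> set as \<subseteq> univ S \<longrightarrow>
        rint S r as = rint T r (map h as))"

text \<open>
  Parameters from a set \<open>A\<close> are supplied by assignments that send the free variables of a formula
  into \<open>A\<close>; the values of an assignment at other variables are irrelevant.
\<close>

definition elementary_on ::
  "('f, 'r) language \<Rightarrow> ('f, 'r, 'a) struct \<Rightarrow> ('f, 'r, 'b) struct \<Rightarrow> 'a set \<Rightarrow> ('a \<Rightarrow> 'b) \<Rightarrow> bool"
where
  "elementary_on L S T A h \<longleftrightarrow> A \<subseteq> univ S \<and> h ` A \<subseteq> univ T \<and>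
     (\<forall>\<phi>\<in>formulas L. \<forall>e. e ` FV \<phi> \<subseteq> A \<longrightarrow> (sat S e \<phi> \<longleftrightarrow> sat T (h \<circ> e) \<phi>))"

definition elementary_extension ::
  "('f, 'r) language \<Rightarrow> ('f, 'r, 'a) struct \<Rightarrow> ('f, 'r, 'a) struct \<Rightarrow> bool" where
  "elementary_extension L M N \<longleftrightarrow> is_struct L M \<and> is_struct L N \<and> univ M \<subseteq> univ N \<and>
     (\<forall>\<phi>\<in>formulas L. \<forall>e. e ` FV \<phi> \<subseteq> univ M \<longrightarrow> (sat M e \<phi> \<longleftrightarrow> sat N e \<phi>))"

text \<open>
  The algebraic closure of \<open>A \<subseteq> N\<close>, computed in \<open>N\<close>; it is unchanged when computed in an
  elementary extension of \<open>N\<close>, in particular in a saturated one.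
\<close>

definition acl :: "('f, 'r) language \<Rightarrow> ('f, 'r, 'a) struct \<Rightarrow> 'a set \<Rightarrow> 'a set" where
  "acl L N A = {a \<in> univ N. \<exists>\<phi>\<in>formulas L. \<exists>x e. e ` (FV \<phi> - {x}) \<subseteq> A \<and>
     sat N (e(x := a)) \<phi> \<and> finite {d \<in> univ N. sat N (e(x := d)) \<phi>}}"

definition acl_over ::
  "('f, 'r) language \<Rightarrow> ('f, 'r, 'a) struct \<Rightarrow> ('f, 'r, 'a) struct \<Rightarrow> 'a set \<Rightarrow> 'a set" where
  "acl_over L M N B = acl L N (univ M \<union> B)"

definition component_map ::
  "('f, 'r) language \<Rightarrow> ('f, 'r, 'a) struct \<Rightarrow> ('f, 'r, 'a) struct \<Rightarrow> ('f, 'r, 'a) struct \<Rightarrow>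
   ('a \<Rightarrow> 'a) \<Rightarrow> bool" where
  "component_map L M N1 N2 h \<longleftrightarrow>
     bij_betw h (univ N1) (univ N2) \<and>
     (\<forall>a\<in>univ M. h a = a) \<and>
     (\<forall>b\<in>univ N1 - univ M.
        elementary_on L N1 N2 (acl_over L M N1 {b}) h \<and>
        h ` acl_over L M N1 {b} = acl_over L M N2 {h b})"

text \<open>The language \<open>L(A)\<close> has the symbols \<open>Inl f\<close> of \<open>L\<close> and a constant \<open>Inr a\<close> for each \<open>a \<in> A\<close>.\<close>

definition lang_consts :: "('f, 'r) language \<Rightarrow> 'a set \<Rightarrow> ('f + 'a, 'r) language" where
  "lang_consts L A =
     \<lparr>Funs = Funs L <+> A, Rels = Rels L, funar = case_sum (funar L) (\<lambda>_. 0), relar = relar L\<rparr>"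

definition canonical_expansion :: "('f, 'r, 'a) struct \<Rightarrow> ('f + 'a, 'r, 'a) struct" where
  "canonical_expansion M =
     \<lparr>univ = univ M, fint = case_sum (fint M) (\<lambda>a _. a), rint = rint M\<rparr>"

definition models :: "('f, 'r, 'a) struct \<Rightarrow> ('f, 'r) fm \<Rightarrow> bool" where
  "models S \<phi> \<longleftrightarrow> (\<forall>e. range e \<subseteq> univ S \<longrightarrow> sat S e \<phi>)"

definition Th :: "('f, 'r) language \<Rightarrow> ('f, 'r, 'a) struct \<Rightarrow> ('f, 'r) fm set" where
  "Th L S = {\<sigma> \<in> formulas L. FV \<sigma> = {} \<and> models S \<sigma>}"

text \<open>
  Equivalence modulo \<open>Th S\<close>: the two formulas agree in every model of \<open>Th S\<close> whose universe
  lives in the type of \<open>S\<close>. The restriction to one type loses nothing, because \<open>Th S\<close> is complete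
  and \<open>S\<close> itself is one of these models.
\<close>

definition Th_equivalent ::
  "('f, 'r) language \<Rightarrow> ('f, 'r, 'a) struct \<Rightarrow> ('f, 'r) fm \<Rightarrow> ('f, 'r) fm \<Rightarrow> bool" where
  "Th_equivalent L S \<phi> \<psi> \<longleftrightarrow>
     (\<forall>T :: ('f, 'r, 'a) struct. is_struct L T \<and> (\<forall>\<sigma>\<in>Th L S. models T \<sigma>) \<longrightarrow>
        (\<forall>e. range e \<subseteq> univ T \<longrightarrow> (sat T e \<phi> \<longleftrightarrow> sat T e \<psi>)))"

text \<open>Tuples are lists, with coordinates indexed by \<open>{..<n}\<close>; \<open>nths b Y\<close> is \<open>\<pi>\<^sub>Y(b)\<close>.\<close>

definition at_most_to_one :: "nat \<Rightarrow> ('b \<Rightarrow> 'c) \<Rightarrow> 'b set \<Rightarrow> bool" where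
  "at_most_to_one K g B \<longleftrightarrow> (\<forall>c. finite {b \<in> B. g b = c} \<and> card {b \<in> B. g b = c} \<le> K)"

definition mutually_algebraic_set :: "'a set \<Rightarrow> nat \<Rightarrow> 'a list set \<Rightarrow> bool" where
  "mutually_algebraic_set A n B \<longleftrightarrow>
     n \<ge> 1 \<and> B \<subseteq> {as. length as = n \<and> set as \<subseteq> A} \<and>
     (\<exists>K. \<forall>X Y. X \<union> Y = {..<n} \<and> X \<inter> Y = {} \<and> X \<noteq> {} \<and> Y \<noteq> {} \<longrightarrow>
        at_most_to_one K (\<lambda>b. nths b Y) B)"

text \<open>The solution set of \<open>\<phi>(z)\<close>, for a tuple \<open>z\<close> of distinct variables that contains \<open>FV \<phi>\<close>.\<close>

definition solution_set ::
  "('f, 'r, 'a) struct \<Rightarrow> ('f, 'r) fm \<Rightarrow> nat list \<Rightarrow> 'a list set" where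
  "solution_set S \<phi> zs = {map e zs | e. range e \<subseteq> univ S \<and> sat S e \<phi>}"

definition MA :: "('f, 'r) language \<Rightarrow> ('f, 'r, 'a) struct \<Rightarrow> ('f + 'a, 'r) fm set" where
  "MA L M = {\<phi> \<in> formulas (lang_consts L (univ M)).
     \<exists>zs. zs \<noteq> [] \<and> distinct zs \<and> FV \<phi> \<subseteq> set zs \<and>
       mutually_algebraic_set (univ M) (length zs) (solution_set (canonical_expansion M) \<phi> zs)}"

inductive_set boolean_combinations :: "('f, 'r) fm set \<Rightarrow> ('f, 'r) fm set"
  for F :: "('f, 'r) fm set" where
  base: "\<phi> \<in> F \<Longrightarrow> \<phi> \<in> boolean_combinations F"
| neg: "\<phi> \<in> boolean_combinations F \<Longrightarrow> Neg \<phi> \<in> boolean_combinations F"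
| conj: "\<phi> \<in> boolean_combinations F \<Longrightarrow> \<psi> \<in> boolean_combinations F \<Longrightarrow>
    Conj \<phi> \<psi> \<in> boolean_combinations F"

definition MA_star :: "('f, 'r) language \<Rightarrow> ('f, 'r, 'a) struct \<Rightarrow> ('f + 'a, 'r) fm set" where
  "MA_star L M = {\<phi> \<in> formulas (lang_consts L (univ M)). \<exists>\<psi>\<in>boolean_combinations (MA L M).
     Th_equivalent (lang_consts L (univ M)) (canonical_expansion M) \<phi> \<psi>}"

definition mutually_algebraic_struct ::
  "('f, 'r) language \<Rightarrow> ('f, 'r, 'a) struct \<Rightarrow> bool" where
  "mutually_algebraic_struct L M \<longleftrightarrow>
     is_struct L M \<and> formulas (lang_consts L (univ M)) \<subseteq> MA_star L M"

end

theory Submission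
  imports Defs
begin

text \<open>
  A component map is only assumed to be elementary on each set \<open>acl\<^sub>M(b)\<close> separately, whereas an
  isomorphism must respect relations between elements of different such sets. The reason that it
  does is that a mutually algebraic formula never relates elements of different components: if a
  solution of it in \<open>N\<^sub>1\<close> has a coordinate \<open>b\<close> outside \<open>M\<close>, then all its other coordinates are
  algebraic over \<open>M \<union> {b}\<close> (\<open>mutually_algebraic_acl\<close>). Indeed, in \<open>M\<close> a given value of one
  coordinate is compatible with at most \<open>K\<close> values of another. For fixed \<open>K\<close> this is a single
  first-order sentence with parameters in \<open>M\<close>, so it passes to every elementary extension.

  Hence a component map \<open>f\<close> preserves each mutually algebraic formula in both directions
  (\<open>component_map_preserves_MA\<close>). A tuple inside \<open>M\<close> is fixed by \<open>f\<close>. For any other solution in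
  \<open>N\<^sub>1\<close>, the whole tuple lies in one \<open>acl\<^sub>M(b)\<close>, where \<open>f\<close> is elementary. For a solution
  \<open>f(e)\<close> in \<open>N\<^sub>2\<close>, the tuple lies in one \<open>acl\<^sub>M(f(b)) = f(acl\<^sub>M(b))\<close>, and injectivity of \<open>f\<close> puts
  \<open>e\<close> into \<open>acl\<^sub>M(b)\<close>. Preservation extends to boolean combinations, and therefore to
  all formulas, since every \<open>L(M)\<close>-formula is equivalent to such a combination modulo the theory of
  \<open>M\<^sub>M\<close>, of which the expansions of \<open>N\<^sub>1\<close> and \<open>N\<^sub>2\<close> are models. Applied to atomic formulas, this
  says that \<open>f\<close> is an isomorphism.

  The converse holds because an isomorphism preserves satisfaction, and so carries algebraic
  closures to algebraic closures.
\<close>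

section \<open>Satisfaction and counting quantifiers\<close>

lemma eval_cong:
  "(\<And>v. v \<in> vars_trm t \<Longrightarrow> e v = e' v) \<Longrightarrow> eval S e t = eval S e' t"
proof (induction t)
  case (App f ts)
  then have "map (eval S e) ts = map (eval S e') ts" by auto
  then show ?case by (simp only: eval.simps)
qed simp

lemma sat_cong:
  "(\<And>v. v \<in> FV \<phi> \<Longrightarrow> e v = e' v) \<Longrightarrow> sat S e \<phi> \<longleftrightarrow> sat S e' \<phi>"
proof (induction \<phi> arbitrary: e e')
  case (Eq s t)
  then have "eval S e s = eval S e' s" "eval S e t = eval S e' t"
    by (auto intro!: eval_cong)
  then show ?case by simp
next
  case (Rel r ts)
  then have "map (eval S e) ts = map (eval S e') ts" by (auto intro!: eval_cong)
  then show ?case by (simp only: sat.simps)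
next
  case (Neg \<phi>)
  have "sat S e \<phi> \<longleftrightarrow> sat S e' \<phi>" by (rule Neg.IH) (simp add: Neg.prems)
  then show ?case by simp
next
  case (Conj \<phi> \<psi>)
  have "sat S e \<phi> \<longleftrightarrow> sat S e' \<phi>" by (rule Conj.IH) (simp add: Conj.prems)
  moreover have "sat S e \<psi> \<longleftrightarrow> sat S e' \<psi>" by (rule Conj.IH) (simp add: Conj.prems)
  ultimately show ?case by simp
next
  case (Exists x \<phi>)
  have "sat S (e(x := a)) \<phi> \<longleftrightarrow> sat S (e'(x := a)) \<phi>" for a
    by (rule Exists.IH) (use Exists.prems in auto)
  then show ?case by simp
qed

lemma eval_in_univ:
  assumes "is_struct L S"
  shows "wf_trm L t \<Longrightarrow> e ` vars_trm t \<subseteq> univ S \<Longrightarrow> eval S e t \<in> univ S"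
proof (induction t)
  case (App f ts)
  then have "set (map (eval S e) ts) \<subseteq> univ S" by fastforce
  then show ?case using App.prems assms by (simp add: is_struct_def)
qed simp

lemma sat_foldr_Exists:
  "sat S e (foldr Exists ws \<phi>) \<longleftrightarrow>
     (\<exists>e'. (\<forall>v. v \<notin> set ws \<longrightarrow> e' v = e v) \<and> e' ` set ws \<subseteq> univ S \<and> sat S e' \<phi>)"
proof (induction ws arbitrary: e)
  case Nil
  have "e' = e" if "\<forall>v. e' v = e v" for e' using that by auto
  then show ?case by auto
next
  case (Cons w ws)
  show ?case
  proof
    assume "sat S e (foldr Exists (w # ws) \<phi>)"
    then obtain a e' where a: "a \<in> univ S"
      and e': "\<forall>v. v \<notin> set ws \<longrightarrow> e' v = (e(w := a)) v" "e' ` set ws \<subseteq> univ S" "sat S e' \<phi>"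
      using Cons.IH by auto
    have "e' w \<in> univ S" using a e' by (cases "w \<in> set ws") auto
    then show "\<exists>e'. (\<forall>v. v \<notin> set (w # ws) \<longrightarrow> e' v = e v) \<and> e' ` set (w # ws) \<subseteq> univ S
        \<and> sat S e' \<phi>"
      using e' by (intro exI[of _ e']) auto
  next
    assume "\<exists>e'. (\<forall>v. v \<notin> set (w # ws) \<longrightarrow> e' v = e v) \<and> e' ` set (w # ws) \<subseteq> univ S
        \<and> sat S e' \<phi>"
    then obtain e' where e': "\<forall>v. v \<notin> set (w # ws) \<longrightarrow> e' v = e v"
      "e' ` set (w # ws) \<subseteq> univ S" "sat S e' \<phi>" by auto
    then have "sat S (e(w := e' w)) (foldr Exists ws \<phi>)"
      unfolding Cons.IH by (intro exI[of _ e']) auto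
    then show "sat S e (foldr Exists (w # ws) \<phi>)" using e'(2) by auto
  qed
qed

lemma FV_foldr_Exists: "FV (foldr Exists ws \<phi>) = FV \<phi> - set ws"
  by (induction ws) auto

lemma wf_foldr_Exists: "wf_fm L (foldr Exists ws \<phi>) \<longleftrightarrow> wf_fm L \<phi>"
  by (induction ws) auto

lemma finite_vars_trm: "finite (vars_trm t)"
  by (induction t) auto

lemma finite_FV: "finite (FV \<phi>)"
  by (induction \<phi>) (auto simp: finite_vars_trm)

definition fresh :: "nat \<Rightarrow> ('f, 'r) fm \<Rightarrow> nat" where
  "fresh x \<phi> = (SOME y. y \<notin> insert x (FV \<phi>))"

lemma fresh: "fresh x \<phi> \<noteq> x" "fresh x \<phi> \<notin> FV \<phi>"
proof -
  have "fresh x \<phi> \<notin> insert x (FV \<phi>)"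
    unfolding fresh_def
    by (rule someI_ex, rule ex_new_if_finite) (simp_all add: finite_FV)
  then show "fresh x \<phi> \<noteq> x" "fresh x \<phi> \<notin> FV \<phi>" by auto
qed

text \<open>
  The counting quantifier \<open>\<exists>\<^sup>\<ge>\<^sup>n x. \<phi>\<close>, built by choosing one witness \<open>y\<close> and excluding it. Writing
  \<open>\<exists>x. x = y \<and> \<phi>\<close> for \<open>\<phi>(y)\<close> makes substitution into formulas unnecessary. The base case must be a
  formula that holds in every structure and has no free variables.
\<close>

fun at_least :: "nat \<Rightarrow> nat \<Rightarrow> ('f, 'r) fm \<Rightarrow> ('f, 'r) fm" where
  "at_least 0 x \<phi> = Exists x (Eq (Var x) (Var x))"
| "at_least (Suc n) x \<phi> =
     (let y = fresh x \<phi> in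
        Exists y (Conj (Exists x (Conj (Eq (Var x) (Var y)) \<phi>))
                       (at_least n x (Conj \<phi> (Neg (Eq (Var x) (Var y)))))))"

lemma wf_at_least: "wf_fm L \<phi> \<Longrightarrow> wf_fm L (at_least n x \<phi>)"
  by (induction n x \<phi> rule: at_least.induct) (auto simp: Let_def)

lemma FV_at_least: "FV (at_least n x \<phi>) \<subseteq> FV \<phi> - {x}"
proof (induction n arbitrary: \<phi>)
  case (Suc n)
  define y where "y = fresh x \<phi>"
  have "FV (at_least n x (Conj \<phi> (Neg (Eq (Var x) (Var y))))) \<subseteq> (FV \<phi> \<union> {x, y}) - {x}"
    using Suc[of "Conj \<phi> (Neg (Eq (Var x) (Var y)))"] by auto
  then show ?case by (auto simp: Let_def y_def[symmetric])
qed simp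

lemma sat_at_least:
  assumes "univ S \<noteq> {}"
  shows "sat S e (at_least n x \<phi>) \<longleftrightarrow>
    (\<exists>D \<subseteq> {d \<in> univ S. sat S (e(x := d)) \<phi>}. finite D \<and> card D = n)"
proof (induction n arbitrary: \<phi> e)
  case 0
  have "\<exists>D \<subseteq> {d \<in> univ S. sat S (e(x := d)) \<phi>}. finite D \<and> card D = 0"
    by (rule exI[of _ "{}"]) simp
  moreover have "sat S e (at_least 0 x \<phi>)" using assms by auto
  ultimately show ?case by blast
next
  case (Suc n)
  define y where "y = fresh x \<phi>"
  have y: "y \<noteq> x" "y \<notin> FV \<phi>" using fresh[of x \<phi>] by (auto simp: y_def)
  have drop_y: "sat S (e(y := c, x := d)) \<phi> \<longleftrightarrow> sat S (e(x := d)) \<phi>" for c d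
    by (rule sat_cong) (use y in auto)
  let ?D = "{d \<in> univ S. sat S (e(x := d)) \<phi>}"
  have "sat S e (at_least (Suc n) x \<phi>) \<longleftrightarrow>
      (\<exists>c\<in>?D. \<exists>D \<subseteq> ?D - {c}. finite D \<and> card D = n)"
  proof -
    let ?\<psi> = "Conj \<phi> (Neg (Eq (Var x) (Var y)))"
    have upd: "(e(y := c, x := d)) x = d" "(e(y := c, x := d)) y = c" for c d
      using y(1) by simp_all
    have "{d \<in> univ S. sat S (e(y := c, x := d)) ?\<psi>} = ?D - {c}" for c
      by (auto simp only: sat.simps eval.simps drop_y upd)
    then have rest: "sat S (e(y := c)) (at_least n x ?\<psi>) \<longleftrightarrow>
        (\<exists>D \<subseteq> ?D - {c}. finite D \<and> card D = n)" for c
      by (simp only: Suc)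
    have first: "c \<in> univ S \<Longrightarrow>
        sat S (e(y := c)) (Exists x (Conj (Eq (Var x) (Var y)) \<phi>)) \<longleftrightarrow> c \<in> ?D" for c
      by (auto simp only: sat.simps eval.simps drop_y upd)
    have "sat S e (at_least (Suc n) x \<phi>) \<longleftrightarrow>
        (\<exists>c\<in>univ S. sat S (e(y := c)) (Exists x (Conj (Eq (Var x) (Var y)) \<phi>))
           \<and> sat S (e(y := c)) (at_least n x ?\<psi>))"
      by (simp only: at_least.simps Let_def y_def sat.simps)
    also have "\<dots> \<longleftrightarrow> (\<exists>c\<in>univ S. c \<in> ?D \<and> (\<exists>D \<subseteq> ?D - {c}. finite D \<and> card D = n))"
      by (intro bex_cong refl) (simp only: first rest)
    also have "(\<exists>c\<in>univ S. c \<in> ?D \<and> R c) \<longleftrightarrow> (\<exists>c\<in>?D. R c)" for R by blast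
    finally show ?thesis .
  qed
  also have "\<dots> \<longleftrightarrow> (\<exists>D \<subseteq> ?D. finite D \<and> card D = Suc n)"
  proof
    assume "\<exists>c\<in>?D. \<exists>D \<subseteq> ?D - {c}. finite D \<and> card D = n"
    then obtain c D where D: "c \<in> ?D" "D \<subseteq> ?D - {c}" "finite D" "card D = n" by blast
    then have "insert c D \<subseteq> ?D" "finite (insert c D)" "card (insert c D) = Suc n"
      using card_insert_disjoint[of D c] by blast+
    then show "\<exists>D \<subseteq> ?D. finite D \<and> card D = Suc n" by blast
  next
    assume "\<exists>D \<subseteq> ?D. finite D \<and> card D = Suc n"
    then obtain D where D: "D \<subseteq> ?D" "finite D" "card D = Suc n" by blast
    then obtain c where c: "c \<in> D" by fastforce
    have "D - {c} \<subseteq> ?D - {c}" "finite (D - {c})" "card (D - {c}) = n"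
      using D c by auto
    then show "\<exists>c\<in>?D. \<exists>D \<subseteq> ?D - {c}. finite D \<and> card D = n" using c D(1) by blast
  qed
  finally show ?case .
qed

section \<open>Parameters as values of variables\<close>

fun consts_trm :: "('f + 'a) trm \<Rightarrow> 'a set" where
  "consts_trm (Var x) = {}"
| "consts_trm (App (Inl f) ts) = (\<Union>t\<in>set ts. consts_trm t)"
| "consts_trm (App (Inr a) ts) = {a}"

fun consts_fm :: "('f + 'a, 'r) fm \<Rightarrow> 'a set" where
  "consts_fm (Eq s t) = consts_trm s \<union> consts_trm t"
| "consts_fm (Rel r ts) = (\<Union>t\<in>set ts. consts_trm t)"
| "consts_fm (Neg \<phi>) = consts_fm \<phi>"
| "consts_fm (Conj \<phi> \<psi>) = consts_fm \<phi> \<union> consts_fm \<psi>"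
| "consts_fm (Exists x \<phi>) = consts_fm \<phi>"

text \<open>
  An \<open>L(M)\<close>-formula is an \<open>L\<close>-formula together with values for some of its variables. Old variables
  move to even positions and the constant \<open>a\<close> becomes the odd variable \<open>2 * k a + 1\<close>, so that no
  quantifier can capture it.
\<close>

fun abstract_trm :: "('a \<Rightarrow> nat) \<Rightarrow> ('f + 'a) trm \<Rightarrow> 'f trm" where
  "abstract_trm k (Var x) = Var (2 * x)"
| "abstract_trm k (App (Inl f) ts) = App f (map (abstract_trm k) ts)"
| "abstract_trm k (App (Inr a) ts) = Var (2 * k a + 1)"

fun abstract_fm :: "('a \<Rightarrow> nat) \<Rightarrow> ('f + 'a, 'r) fm \<Rightarrow> ('f, 'r) fm" where
  "abstract_fm k (Eq s t) = Eq (abstract_trm k s) (abstract_trm k t)"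
| "abstract_fm k (Rel r ts) = Rel r (map (abstract_trm k) ts)"
| "abstract_fm k (Neg \<phi>) = Neg (abstract_fm k \<phi>)"
| "abstract_fm k (Conj \<phi> \<psi>) = Conj (abstract_fm k \<phi>) (abstract_fm k \<psi>)"
| "abstract_fm k (Exists x \<phi>) = Exists (2 * x) (abstract_fm k \<phi>)"

definition interleave :: "(nat \<Rightarrow> 'a) \<Rightarrow> (nat \<Rightarrow> 'a) \<Rightarrow> nat \<Rightarrow> 'a" where
  "interleave e d v = (if even v then e (v div 2) else d (v div 2))"

lemma interleave_upd: "(interleave e d)(2 * x := a) = interleave (e(x := a)) d"
  by (auto simp: interleave_def fun_eq_iff)

lemma finite_consts_trm: "finite (consts_trm t)"
  by (induction t rule: consts_trm.induct) auto

lemma finite_consts_fm: "finite (consts_fm \<phi>)"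
  by (induction \<phi>) (auto simp: finite_consts_trm)

lemma consts_trm_subset: "wf_trm (lang_consts L C) t \<Longrightarrow> consts_trm t \<subseteq> C"
  by (induction t rule: consts_trm.induct) (auto simp: lang_consts_def)

lemma consts_fm_subset: "wf_fm (lang_consts L C) \<phi> \<Longrightarrow> consts_fm \<phi> \<subseteq> C"
proof (induction \<phi>)
  case (Rel r ts)
  then show ?case using consts_trm_subset[of L C] by fastforce
qed (use consts_trm_subset[of L C] in auto)

lemma wf_abstract_trm: "wf_trm (lang_consts L C) t \<Longrightarrow> wf_trm L (abstract_trm k t)"
  by (induction t rule: consts_trm.induct) (auto simp: lang_consts_def)

lemma wf_abstract_fm: "wf_fm (lang_consts L C) \<phi> \<Longrightarrow> wf_fm L (abstract_fm k \<phi>)"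
proof (induction \<phi>)
  case (Rel r ts)
  then show ?case using wf_abstract_trm[of L C _ k] by (auto simp: lang_consts_def)
qed (use wf_abstract_trm[of L C _ k] in auto)

lemma vars_abstract_trm:
  "vars_trm (abstract_trm k t) \<subseteq> (*) 2 ` vars_trm t \<union> (\<lambda>a. 2 * k a + 1) ` consts_trm t"
proof (induction t rule: consts_trm.induct)
  case (2 f ts)
  have "(\<Union>t\<in>set ts. vars_trm (abstract_trm k t)) \<subseteq>
      (\<Union>t\<in>set ts. (*) 2 ` vars_trm t \<union> (\<lambda>a. 2 * k a + 1) ` consts_trm t)"
    by (intro UN_mono order_refl 2)
  then show ?case by (simp add: image_UN UN_Un_distrib)
qed auto

lemma FV_abstract_fm:
  "FV (abstract_fm k \<phi>) \<subseteq> (*) 2 ` FV \<phi> \<union> (\<lambda>a. 2 * k a + 1) ` consts_fm \<phi>"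
proof (induction \<phi>)
  case (Eq s t)
  then show ?case using vars_abstract_trm[of k s] vars_abstract_trm[of k t] by auto
next
  case (Rel r ts)
  have "(\<Union>t\<in>set ts. vars_trm (abstract_trm k t)) \<subseteq>
      (\<Union>t\<in>set ts. (*) 2 ` vars_trm t \<union> (\<lambda>a. 2 * k a + 1) ` consts_trm t)"
    by (intro UN_mono vars_abstract_trm order_refl)
  then show ?case by (simp add: image_UN UN_Un_distrib)
qed auto

lemma expansion_simps [simp]:
  "univ (canonical_expansion S) = univ S"
  "fint (canonical_expansion S) (Inl f) = fint S f"
  "fint (canonical_expansion S) (Inr a) as = a"
  "rint (canonical_expansion S) = rint S"
  by (simp_all add: canonical_expansion_def)

lemma eval_abstract_trm:
  "\<forall>a\<in>consts_trm t. d (k a) = a \<Longrightarrow>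
     eval (canonical_expansion S) e t = eval S (interleave e d) (abstract_trm k t)"
proof (induction t rule: consts_trm.induct)
  case (2 f ts)
  then have "map (eval (canonical_expansion S) e) ts
      = map (eval S (interleave e d) \<circ> abstract_trm k) ts" by auto
  then show ?case by (simp only: eval.simps abstract_trm.simps map_map expansion_simps)
qed (auto simp: interleave_def)

lemma sat_abstract_fm:
  "\<forall>a\<in>consts_fm \<phi>. d (k a) = a \<Longrightarrow>
     sat (canonical_expansion S) e \<phi> \<longleftrightarrow> sat S (interleave e d) (abstract_fm k \<phi>)"
proof (induction \<phi> arbitrary: e)
  case (Eq s t)
  then show ?case by (simp add: eval_abstract_trm[where d = d and k = k])
next
  case (Rel r ts)
  then have "map (eval (canonical_expansion S) e) ts
      = map (eval S (interleave e d) \<circ> abstract_trm k) ts"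
    by (auto simp: eval_abstract_trm[where d = d and k = k])
  then show ?case by (simp only: sat.simps abstract_fm.simps map_map expansion_simps)
next
  case (Exists x \<phi>)
  then show ?case by (simp add: interleave_upd)
qed auto

text \<open>
  Elementarity and algebraic closure are phrased with \<open>L\<close>-formulas and parameters, mutual
  algebraicity with \<open>L(M)\<close>-formulas; this is the passage between the two. The assignment \<open>d\<close> of
  values to the new variables depends only on the formula, so that one \<open>\<psi>\<close> and one \<open>d\<close> serve
  several structures at once.
\<close>

lemma parameters_as_variables:
  fixes \<phi> :: "('f + 'a, 'r) fm"
  assumes "\<phi> \<in> formulas (lang_consts L C)"
  obtains \<psi> d where "\<psi> \<in> formulas L"
    and "\<And>v. v \<in> FV \<psi> \<Longrightarrow> if even v then v div 2 \<in> FV \<phi> else d (v div 2) \<in> C"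
    and "\<And>(S :: ('f, 'r, 'a) struct) e.
      sat (canonical_expansion S) e \<phi> \<longleftrightarrow> sat S (interleave e d) \<psi>"
proof -
  obtain k :: "'a \<Rightarrow> nat" where k: "inj_on k (consts_fm \<phi>)"
    using finite_imp_inj_to_nat_seg[OF finite_consts_fm[of \<phi>]] by metis
  (* Only finitely many constants occur, so they can be numbered and then decoded from their numbers. *)
  define d where "d = inv_into (consts_fm \<phi>) k"
  have d: "\<forall>a\<in>consts_fm \<phi>. d (k a) = a" using k by (simp add: d_def)
  have wf: "wf_fm (lang_consts L C) \<phi>" using assms by (simp add: formulas_def)
  show thesis
  proof (rule that)
    show "abstract_fm k \<phi> \<in> formulas L" using wf_abstract_fm[OF wf] by (simp add: formulas_def)
    show "if even v then v div 2 \<in> FV \<phi> else d (v div 2) \<in> C" if "v \<in> FV (abstract_fm k \<phi>)" for v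
      using subsetD[OF FV_abstract_fm that]
    proof (elim UnE imageE)
      fix a assume "v = 2 * k a + 1" "a \<in> consts_fm \<phi>"
      then show ?thesis using consts_fm_subset[OF wf] d by auto
    qed simp
    show "sat (canonical_expansion S) e \<phi> \<longleftrightarrow> sat S (interleave e d) (abstract_fm k \<phi>)"
      for S :: "('f, 'r, 'a) struct" and e
      by (rule sat_abstract_fm[OF d])
  qed
qed

lemma elementary_on_expansion:
  fixes N1 N2 :: "('f, 'r, 'a) struct"
  assumes h: "elementary_on L N1 N2 A h" "C \<subseteq> A" "\<And>a. a \<in> C \<Longrightarrow> h a = a"
    and \<phi>: "\<phi> \<in> formulas (lang_consts L C)" and e: "e ` FV \<phi> \<subseteq> A"
  shows "sat (canonical_expansion N1) e \<phi> \<longleftrightarrow> sat (canonical_expansion N2) (h \<circ> e) \<phi>"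
proof -
  obtain \<psi> d where \<psi>: "\<psi> \<in> formulas L"
    and FV: "\<And>v. v \<in> FV \<psi> \<Longrightarrow> if even v then v div 2 \<in> FV \<phi> else d (v div 2) \<in> C"
    and sat: "\<And>(S :: ('f, 'r, 'a) struct) e.
      sat (canonical_expansion S) e \<phi> \<longleftrightarrow> sat S (interleave e d) \<psi>"
    using parameters_as_variables[OF \<phi>] by metis
  have "interleave e d ` FV \<psi> \<subseteq> A"
    using FV e h(2) by (fastforce simp: interleave_def)
  then have "sat N1 (interleave e d) \<psi> \<longleftrightarrow> sat N2 (h \<circ> interleave e d) \<psi>"
    using h(1) \<psi> by (simp add: elementary_on_def)
  also have "\<dots> \<longleftrightarrow> sat N2 (interleave (h \<circ> e) d) \<psi>"
    using FV h(3) by (intro sat_cong) (fastforce simp: interleave_def)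
  finally show ?thesis by (simp add: sat)
qed

lemma elementary_extension_expansion:
  fixes M N :: "('f, 'r, 'a) struct"
  assumes "elementary_extension L M N"
    and "\<phi> \<in> formulas (lang_consts L (univ M))" and "e ` FV \<phi> \<subseteq> univ M"
  shows "sat (canonical_expansion M) e \<phi> \<longleftrightarrow> sat (canonical_expansion N) e \<phi>"
proof -
  have "elementary_on L M N (univ M) id"
    using assms(1) by (auto simp: elementary_on_def elementary_extension_def)
  from elementary_on_expansion[OF this _ _ assms(2,3)] show ?thesis by simp
qed

lemma aclI:
  assumes "\<phi> \<in> formulas L" and "e ` (FV \<phi> - {x}) \<subseteq> A"
    and "a \<in> univ N" "sat N (e(x := a)) \<phi>" "finite {d \<in> univ N. sat N (e(x := d)) \<phi>}"
  shows "a \<in> acl L N A"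
  unfolding acl_def mem_Collect_eq
  using assms by (intro conjI bexI[of _ \<phi>] exI[of _ x] exI[of _ e])

lemma acl_expansionI:
  fixes N :: "('f, 'r, 'a) struct"
  assumes \<phi>: "\<phi> \<in> formulas (lang_consts L C)" and "C \<subseteq> A" and e: "e ` (FV \<phi> - {x}) \<subseteq> A"
    and a: "a \<in> univ N" "sat (canonical_expansion N) (e(x := a)) \<phi>"
    and fin: "finite {d \<in> univ N. sat (canonical_expansion N) (e(x := d)) \<phi>}"
  shows "a \<in> acl L N A"
proof -
  obtain \<psi> d where \<psi>: "\<psi> \<in> formulas L"
    and FV: "\<And>v. v \<in> FV \<psi> \<Longrightarrow> if even v then v div 2 \<in> FV \<phi> else d (v div 2) \<in> C"
    and sat: "\<And>(S :: ('f, 'r, 'a) struct) e.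
      sat (canonical_expansion S) e \<phi> \<longleftrightarrow> sat S (interleave e d) \<psi>"
    using parameters_as_variables[OF \<phi>] by metis
  have "interleave e d v \<in> A" if v: "v \<in> FV \<psi> - {2 * x}" for v
  proof (cases "even v")
    case True
    then have "v div 2 \<in> FV \<phi> - {x}" using FV[of v] v by auto
    then show ?thesis using e True by (auto simp: interleave_def)
  next
    case False
    then show ?thesis using FV[of v] v \<open>C \<subseteq> A\<close> by (auto simp: interleave_def)
  qed
  then have "interleave e d ` (FV \<psi> - {2 * x}) \<subseteq> A" by blast
  moreover have "sat N ((interleave e d)(2 * x := c)) \<psi> \<longleftrightarrow>
      sat (canonical_expansion N) (e(x := c)) \<phi>" for c
    by (simp add: sat interleave_upd)
  ultimately show ?thesis
    using aclI[of \<psi> L "interleave e d" "2 * x" A a N] \<psi> a fin by simp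
qed

text \<open>An element \<open>a\<close> of \<open>A\<close> is the only solution of \<open>x = a\<close>.\<close>

lemma subset_acl: "A \<subseteq> univ N \<Longrightarrow> A \<subseteq> acl L N A"
proof
  fix a assume "A \<subseteq> univ N" "a \<in> A"
  then show "a \<in> acl L N A"
    by (intro aclI[of "Eq (Var 0) (Var 1)" L "\<lambda>_. a" 0]) (auto simp: formulas_def)
qed

section \<open>Solutions of mutually algebraic formulas\<close>

lemma nths_singleton: "i < length xs \<Longrightarrow> nths xs {i} = [xs ! i]"
  by (induction xs arbitrary: i) (auto simp: nths_Cons less_Suc_eq_0_disj)

text \<open>
  The key property of mutually algebraic formulas. Let \<open>\<chi>(x, y)\<close> be \<open>\<phi>\<close> with its other variables
  quantified away. A witness for \<open>\<chi>(b, c)\<close> in \<open>M\<close> is a solution of \<open>\<phi>\<close> in the fibre over \<open>b\<close> of the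
  projection to the coordinate \<open>x\<close>, and different \<open>c\<close> give different solutions. So \<open>M\<close> refutes the
  sentence that some \<open>b\<close> has more than \<open>K\<close> values \<open>c\<close>. Then \<open>N\<close> refutes it as well, which makes
  \<open>\<chi>(e x, y)\<close> a witness that \<open>e y\<close> is algebraic.
\<close>

lemma mutually_algebraic_acl:
  fixes M N :: "('f, 'r, 'a) struct"
  assumes \<phi>: "\<phi> \<in> MA L M" and MN: "elementary_extension L M N"
    and e: "range e \<subseteq> univ N" "sat (canonical_expansion N) e \<phi>"
    and xy: "x \<in> FV \<phi>" "y \<in> FV \<phi>"
  shows "e y \<in> acl_over L M N {e x}"
proof (cases "x = y")
  case True
  have "univ M \<union> {e x} \<subseteq> univ N" using e MN by (auto simp: elementary_extension_def)
  then show ?thesis using True subset_acl[of "univ M \<union> {e x}" N L] by (auto simp: acl_over_def)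
next
  case False
  let ?LM = "lang_consts L (univ M)"
  have wf: "\<phi> \<in> formulas ?LM" using \<phi> by (simp add: MA_def)
  obtain zs where zs: "distinct zs" "FV \<phi> \<subseteq> set zs"
    and MA: "mutually_algebraic_set (univ M) (length zs) (solution_set (canonical_expansion M) \<phi> zs)"
    using \<phi> by (auto simp: MA_def)
  obtain i j where i: "i < length zs" "zs ! i = x" and j: "j < length zs" "zs ! j = y"
    using xy zs(2) by (metis in_set_conv_nth subsetD)
  have "i \<noteq> j" using False i j by auto
  let ?B = "solution_set (canonical_expansion M) \<phi> zs"
  obtain K where "\<And>X Y. \<lbrakk>X \<union> Y = {..<length zs}; X \<inter> Y = {}; X \<noteq> {}; Y \<noteq> {}\<rbrakk> \<Longrightarrow>
      at_most_to_one K (\<lambda>b. nths b Y) ?B"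
    using MA unfolding mutually_algebraic_set_def by meson
  from this[of "{..<length zs} - {i}" "{i}"] have
    K: "at_most_to_one K (\<lambda>b. nths b {i}) ?B" using i(1) j(1) \<open>i \<noteq> j\<close> by auto
  obtain ws where ws: "set ws = FV \<phi> - {x, y}"
    using finite_list[of "FV \<phi> - {x, y}"] finite_FV by blast
  define \<chi> where "\<chi> = foldr Exists ws \<phi>"
  have FV_\<chi>: "FV \<chi> = {x, y}" using xy ws by (auto simp: \<chi>_def FV_foldr_Exists)
  have wf_\<chi>: "\<chi> \<in> formulas ?LM" using wf by (simp add: \<chi>_def formulas_def wf_foldr_Exists)
  define \<sigma> where "\<sigma> = Exists x (at_least (Suc K) y \<chi>)"
  have \<sigma>: "\<sigma> \<in> formulas ?LM" "FV \<sigma> = {}"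
    using wf_\<chi> FV_at_least[of "Suc K" y \<chi>]
    by (auto simp: \<sigma>_def formulas_def wf_at_least FV_\<chi> simp del: at_least.simps)
  have nonempty: "univ M \<noteq> {}" "univ N \<noteq> {}"
    using MN by (auto simp: elementary_extension_def is_struct_def)
  obtain m0 where m0: "m0 \<in> univ M" using nonempty by blast
  have "\<not> sat (canonical_expansion M) (\<lambda>_. m0) \<sigma>"
  proof
    assume "sat (canonical_expansion M) (\<lambda>_. m0) \<sigma>"
    then obtain b where b: "b \<in> univ M"
      and "sat (canonical_expansion M) ((\<lambda>_. m0)(x := b)) (at_least (Suc K) y \<chi>)"
      by (auto simp: \<sigma>_def simp del: at_least.simps)
    then obtain D where
      D: "D \<subseteq> {c \<in> univ M. sat (canonical_expansion M) ((\<lambda>_. m0)(x := b, y := c)) \<chi>}"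
        "finite D" "card D = Suc K"
      unfolding sat_at_least[of "canonical_expansion M", unfolded expansion_simps, OF nonempty(1)]
      by blast
    (* Each of the K + 1 values occurs at position j in some element of one fibre of size at most K. *)
    let ?F = "{t \<in> ?B. nths t {i} = [b]}"
    have "D \<subseteq> (\<lambda>t. t ! j) ` ?F"
    proof
      fix c assume "c \<in> D"
      then obtain g where c: "c \<in> univ M" and
        g: "\<forall>v. v \<notin> set ws \<longrightarrow> g v = ((\<lambda>_. m0)(x := b, y := c)) v"
          "g ` set ws \<subseteq> univ M" "sat (canonical_expansion M) g \<phi>"
        using D(1) unfolding \<chi>_def sat_foldr_Exists expansion_simps by blast
      have "g v \<in> univ M" for v using g(1,2) b c m0 by (cases "v \<in> set ws") auto
      then have "map g zs \<in> ?B" using g(3) by (auto simp: solution_set_def)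
      moreover have "g x = b" "g y = c" using g(1) ws False by auto
      ultimately have "map g zs \<in> ?F" "map g zs ! j = c"
        using i j by (auto simp: nths_singleton)
      then show "c \<in> (\<lambda>t. t ! j) ` ?F" by blast
    qed
    moreover have "finite ?F" "card ?F \<le> K" using K by (auto simp: at_most_to_one_def)
    ultimately have "card D \<le> K"
      by (meson card_image_le card_mono finite_imageI le_trans)
    then show False using D(3) by simp
  qed
  then have "\<not> sat (canonical_expansion N) (\<lambda>_. m0) \<sigma>"
    using elementary_extension_expansion[OF MN \<sigma>(1)] \<sigma>(2) by simp
  then have "\<not> sat (canonical_expansion N) e \<sigma>"
    using sat_cong[of \<sigma> e "\<lambda>_. m0"] \<sigma>(2) by simp
  moreover have "e x \<in> univ N" using e(1) by blast
  ultimately have "\<not> sat (canonical_expansion N) (e(x := e x)) (at_least (Suc K) y \<chi>)"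
    unfolding \<sigma>_def sat.simps expansion_simps by blast
  then have "\<nexists>D. D \<subseteq> {c \<in> univ N. sat (canonical_expansion N) (e(y := c)) \<chi>}
      \<and> finite D \<and> card D = Suc K"
    unfolding fun_upd_triv
      sat_at_least[of "canonical_expansion N", unfolded expansion_simps, OF nonempty(2)] .
  then have fin: "finite {c \<in> univ N. sat (canonical_expansion N) (e(y := c)) \<chi>}"
    using infinite_arbitrarily_large by blast
  have "sat (canonical_expansion N) e \<chi>"
    unfolding \<chi>_def sat_foldr_Exists expansion_simps using e by blast
  then show ?thesis
    unfolding acl_over_def
    by (intro acl_expansionI[OF wf_\<chi> _ _ _ _ fin]) (use e(1) FV_\<chi> in auto)
qed

section \<open>Component maps are isomorphisms\<close>

text \<open>
  If the tuple leaves \<open>M\<close> at the variable \<open>x\<close>, satisfaction on either side forces it into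
  \<open>acl\<^sub>M(e x)\<close>, where \<open>f\<close> is elementary. If it is satisfied on neither side there is nothing to show,
  although the tuple may then be spread over several components.
\<close>

lemma component_map_preserves_MA:
  fixes M N1 N2 :: "('f, 'r, 'a) struct"
  assumes MN1: "elementary_extension L M N1" and MN2: "elementary_extension L M N2"
    and f: "component_map L M N1 N2 f" and \<phi>: "\<phi> \<in> MA L M" and e: "range e \<subseteq> univ N1"
  shows "sat (canonical_expansion N1) e \<phi> \<longleftrightarrow> sat (canonical_expansion N2) (f \<circ> e) \<phi>"
proof -
  have wf: "\<phi> \<in> formulas (lang_consts L (univ M))" using \<phi> by (simp add: MA_def)
  have bij: "bij_betw f (univ N1) (univ N2)" and fix_M: "\<And>a. a \<in> univ M \<Longrightarrow> f a = a"
    using f by (auto simp: component_map_def)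
  have sub: "univ M \<subseteq> univ N1" using MN1 by (simp add: elementary_extension_def)
  have fe: "range (f \<circ> e) \<subseteq> univ N2" using e bij by (auto simp: bij_betw_def)
  show ?thesis
  proof (cases "e ` FV \<phi> \<subseteq> univ M")
    case True
    then have "sat (canonical_expansion N2) (f \<circ> e) \<phi> \<longleftrightarrow> sat (canonical_expansion N2) e \<phi>"
      by (intro sat_cong) (auto simp: fix_M)
    then show ?thesis
      using elementary_extension_expansion[OF MN1 wf True]
        elementary_extension_expansion[OF MN2 wf True] by simp
  next
    case False
    then obtain x where x: "x \<in> FV \<phi>" "e x \<notin> univ M" by blast
    let ?A = "acl_over L M N1 {e x}"
    have "e x \<in> univ N1 - univ M" using x e by auto
    then have elem: "elementary_on L N1 N2 ?A f" and img: "f ` ?A = acl_over L M N2 {f (e x)}"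
      using f by (simp_all add: component_map_def)
    have A: "?A \<subseteq> univ N1" by (auto simp: acl_over_def acl_def)
    have "univ M \<union> {e x} \<subseteq> univ N1" using sub e by auto
    then have MA: "univ M \<subseteq> ?A" using subset_acl[of "univ M \<union> {e x}" N1 L] by (simp add: acl_over_def)
    have iff: "sat (canonical_expansion N1) e \<phi> \<longleftrightarrow> sat (canonical_expansion N2) (f \<circ> e) \<phi>"
      if "e ` FV \<phi> \<subseteq> ?A"
      using elementary_on_expansion[OF elem MA fix_M wf that] by simp
    show ?thesis
    proof
      assume s: "sat (canonical_expansion N1) e \<phi>"
      then have "e ` FV \<phi> \<subseteq> ?A"
        using mutually_algebraic_acl[OF \<phi> MN1 e] x(1) by blast
      with s show "sat (canonical_expansion N2) (f \<circ> e) \<phi>" by (simp add: iff)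
    next
      assume s: "sat (canonical_expansion N2) (f \<circ> e) \<phi>"
      have "e y \<in> ?A" if "y \<in> FV \<phi>" for y
      proof -
        have "f (e y) \<in> f ` ?A"
          using mutually_algebraic_acl[OF \<phi> MN2 fe s x(1) that] by (simp add: img)
        then obtain c where "c \<in> ?A" "f (e y) = f c" by blast
        then show ?thesis
          using bij A e by (metis bij_betw_imp_inj_on inj_onD rangeI subsetD)
      qed
      then have "e ` FV \<phi> \<subseteq> ?A" by blast
      with s show "sat (canonical_expansion N1) e \<phi>" by (simp add: iff)
    qed
  qed
qed

text \<open>
  Sentences of \<open>L(M)\<close> pass from \<open>M\<close> to \<open>N\<close>, so the expansion of \<open>N\<close> by names for \<open>M\<close> is a model of
  \<open>Th(M\<^sub>M)\<close>. This expansion is \<open>canonical_expansion N\<close>, read in the smaller language \<open>L(M)\<close>.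
\<close>

lemma Th_equivalent_extension:
  fixes M N :: "('f, 'r, 'a) struct"
  assumes MN: "elementary_extension L M N"
    and eq: "Th_equivalent (lang_consts L (univ M)) (canonical_expansion M) \<phi> \<psi>"
    and e: "range e \<subseteq> univ N"
  shows "sat (canonical_expansion N) e \<phi> \<longleftrightarrow> sat (canonical_expansion N) e \<psi>"
proof -
  let ?LM = "lang_consts L (univ M)"
  have N: "is_struct L N" "univ M \<subseteq> univ N" "univ M \<noteq> {}"
    using MN by (auto simp: elementary_extension_def is_struct_def)
  have "is_struct ?LM (canonical_expansion N)"
    using N(1,2) by (auto simp: is_struct_def lang_consts_def)
  moreover have "models (canonical_expansion N) \<sigma>"
    if "\<sigma> \<in> Th ?LM (canonical_expansion M)" for \<sigma>
  proof -
    obtain m where m: "m \<in> univ M" using N(3) by blast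
    have \<sigma>: "\<sigma> \<in> formulas ?LM" "FV \<sigma> = {}" "sat (canonical_expansion M) (\<lambda>_. m) \<sigma>"
      using that m by (auto simp: Th_def models_def)
    then have "sat (canonical_expansion N) (\<lambda>_. m) \<sigma>"
      using elementary_extension_expansion[OF MN \<sigma>(1)] by simp
    moreover have "sat (canonical_expansion N) g \<sigma> \<longleftrightarrow> sat (canonical_expansion N) (\<lambda>_. m) \<sigma>" for g
      by (rule sat_cong) (simp add: \<sigma>(2))
    ultimately show ?thesis by (simp add: models_def)
  qed
  moreover have "range e \<subseteq> univ (canonical_expansion N)"
    using e by simp
  ultimately show ?thesis using eq unfolding Th_equivalent_def by blast
qed

lemma component_map_preserves_all:
  fixes M N1 N2 :: "('f, 'r, 'a) struct"
  assumes M: "mutually_algebraic_struct L M"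
    and MN1: "elementary_extension L M N1" and MN2: "elementary_extension L M N2"
    and f: "component_map L M N1 N2 f"
    and \<phi>: "\<phi> \<in> formulas (lang_consts L (univ M))" and e: "range e \<subseteq> univ N1"
  shows "sat (canonical_expansion N1) e \<phi> \<longleftrightarrow> sat (canonical_expansion N2) (f \<circ> e) \<phi>"
proof -
  obtain \<psi> where \<psi>: "\<psi> \<in> boolean_combinations (MA L M)"
    and eq: "Th_equivalent (lang_consts L (univ M)) (canonical_expansion M) \<phi> \<psi>"
    using M \<phi> by (auto simp: mutually_algebraic_struct_def MA_star_def)
  have fe: "range (f \<circ> e) \<subseteq> univ N2"
    using e f by (auto simp: component_map_def bij_betw_def)
  from \<psi> have "sat (canonical_expansion N1) e \<psi> \<longleftrightarrow> sat (canonical_expansion N2) (f \<circ> e) \<psi>"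
    by induction (auto simp: component_map_preserves_MA[OF MN1 MN2 f _ e, unfolded comp_def] comp_def)
  then show ?thesis
    using Th_equivalent_extension[OF MN1 eq e] Th_equivalent_extension[OF MN2 eq fe] by simp
qed

lemma component_map_isomorphism:
  fixes M N1 N2 :: "('f, 'r, 'a) struct"
  assumes M: "mutually_algebraic_struct L M"
    and MN1: "elementary_extension L M N1" and MN2: "elementary_extension L M N2"
    and f: "component_map L M N1 N2 f"
  shows "isomorphism L N1 N2 f"
proof -
  note pres = component_map_preserves_all[OF M MN1 MN2 f]
  have N1: "is_struct L N1" using MN1 by (simp add: elementary_extension_def)
  have fint: "f (fint N1 g as) = fint N2 g (map f as)"
    if g: "g \<in> Funs L" and as: "length as = funar L g" "set as \<subseteq> univ N1" for g as
  proof -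
    let ?n = "length as"
    (* The graph of g, with its value at the variable following the arguments. *)
    let ?\<phi> = "Eq (App (Inl g) (map Var [0..<?n])) (Var ?n)
      :: ('f + 'a, 'r) fm"
    define e where "e = (\<lambda>v. if v < ?n then as ! v else fint N1 g as)"
    have "fint N1 g as \<in> univ N1" using N1 g as by (simp add: is_struct_def)
    then have e: "range e \<subseteq> univ N1" using as(2) by (auto simp: e_def)
    have map_e: "map e [0..<?n] = as" by (auto simp: e_def intro: nth_equalityI)
    have map_fe: "map (\<lambda>v. f (e v)) [0..<?n] = map f as"
      by (auto simp: e_def intro: nth_equalityI)
    have "?\<phi> \<in> formulas (lang_consts L (univ M))"
      using g as by (auto simp: formulas_def lang_consts_def)
    from pres[OF this e] show ?thesis
      by (simp add: comp_def map_e map_fe) (simp add: e_def)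
  qed
  have rint: "rint N1 r as = rint N2 r (map f as)"
    if r: "r \<in> Rels L" and as: "length as = relar L r" "set as \<subseteq> univ N1" for r as
  proof -
    let ?n = "length as"
    let ?\<phi> = "Rel r (map Var [0..<?n]) :: ('f + 'a, 'r) fm"
    obtain a0 where a0: "a0 \<in> univ N1" using N1 by (auto simp: is_struct_def)
    define e where "e = (\<lambda>v. if v < ?n then as ! v else a0)"
    have e: "range e \<subseteq> univ N1" using as(2) a0 by (auto simp: e_def)
    have map_e: "map e [0..<?n] = as" by (auto simp: e_def intro: nth_equalityI)
    have map_fe: "map (\<lambda>v. f (e v)) [0..<?n] = map f as"
      by (auto simp: e_def intro: nth_equalityI)
    have "?\<phi> \<in> formulas (lang_consts L (univ M))"
      using r as by (auto simp: formulas_def lang_consts_def)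
    from pres[OF this e] show ?thesis
      by (simp add: comp_def map_e map_fe)
  qed
  show ?thesis
    using f fint rint by (simp add: isomorphism_def component_map_def)
qed

section \<open>Isomorphisms over \<open>M\<close> are component maps\<close>

lemma isomorphism_eval:
  assumes "is_struct L S" "isomorphism L S T h"
  shows "wf_trm L t \<Longrightarrow> e ` vars_trm t \<subseteq> univ S \<Longrightarrow> eval T (h \<circ> e) t = h (eval S e t)"
proof (induction t)
  case (App f ts)
  have IH: "map (eval T (h \<circ> e)) ts = map h (map (eval S e) ts)" using App by fastforce
  have "set (map (eval S e) ts) \<subseteq> univ S"
    using App.prems eval_in_univ[OF assms(1)] by fastforce
  moreover have "f \<in> Funs L" "length (map (eval S e) ts) = funar L f" using App.prems by auto
  ultimately have "h (fint S f (map (eval S e) ts)) = fint T f (map h (map (eval S e) ts))"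
    using assms(2) unfolding isomorphism_def by blast
  then show ?case by (simp only: eval.simps IH)
qed simp

lemma isomorphism_sat:
  assumes S: "is_struct L S" and h: "isomorphism L S T h"
  shows "wf_fm L \<phi> \<Longrightarrow> e ` FV \<phi> \<subseteq> univ S \<Longrightarrow> sat S e \<phi> \<longleftrightarrow> sat T (h \<circ> e) \<phi>"
proof (induction \<phi> arbitrary: e)
  case (Eq s t)
  have "eval S e s \<in> univ S" "eval S e t \<in> univ S"
    using Eq by (auto intro!: eval_in_univ[OF S])
  moreover have "inj_on h (univ S)" using h by (simp add: isomorphism_def bij_betw_def)
  moreover have "eval T (h \<circ> e) s = h (eval S e s)" "eval T (h \<circ> e) t = h (eval S e t)"
    using Eq by (auto intro!: isomorphism_eval[OF S h])
  ultimately show ?case by (simp only: sat.simps inj_on_eq_iff)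
next
  case (Rel r ts)
  have ev: "map (eval T (h \<circ> e)) ts = map h (map (eval S e) ts)"
    using Rel by (fastforce intro: isomorphism_eval[OF S h])
  have "set (map (eval S e) ts) \<subseteq> univ S"
    using Rel eval_in_univ[OF S] by fastforce
  moreover have "r \<in> Rels L" "length (map (eval S e) ts) = relar L r" using Rel by auto
  ultimately have "rint S r (map (eval S e) ts) = rint T r (map h (map (eval S e) ts))"
    using h unfolding isomorphism_def by blast
  then show ?case by (simp only: sat.simps ev)
next
  case (Conj \<phi> \<psi>)
  then show ?case by (simp add: image_Un)
next
  case (Exists x \<phi>)
  have "sat S (e(x := a)) \<phi> \<longleftrightarrow> sat T ((h \<circ> e)(x := h a)) \<phi>" if "a \<in> univ S" for a
  proof -
    have "sat S (e(x := a)) \<phi> \<longleftrightarrow> sat T (h \<circ> (e(x := a))) \<phi>"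
      by (rule Exists.IH) (use Exists.prems that in auto)
    then show ?thesis by (simp only: fun_upd_comp)
  qed
  moreover have "univ T = h ` univ S" using h by (simp add: isomorphism_def bij_betw_def)
  ultimately show ?case by (simp only: sat.simps bex_simps cong: bex_cong)
qed simp

lemma isomorphism_elementary_on:
  assumes S: "is_struct L S" and h: "isomorphism L S T h" and A: "A \<subseteq> univ S"
  shows "elementary_on L S T A h"
  unfolding elementary_on_def
proof (intro conjI ballI allI impI)
  show "h ` A \<subseteq> univ T" using h A by (auto simp: isomorphism_def bij_betw_def)
  fix \<phi> e assume "\<phi> \<in> formulas L" "e ` FV \<phi> \<subseteq> A"
  then show "sat S e \<phi> \<longleftrightarrow> sat T (h \<circ> e) \<phi>"
    using isomorphism_sat[OF S h] A by (auto simp: formulas_def simp del: comp_apply)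
qed (rule A)

lemma isomorphism_inv:
  assumes S: "is_struct L S" and h: "isomorphism L S T h"
  shows "isomorphism L T S (inv_into (univ S) h)"
proof -
  let ?g = "inv_into (univ S) h"
  have bij: "bij_betw h (univ S) (univ T)" using h by (simp add: isomorphism_def)
  have g: "set (map ?g as) \<subseteq> univ S" "map h (map ?g as) = as" if "set as \<subseteq> univ T" for as
    using that bij by (auto simp: bij_betw_def inv_into_into f_inv_into_f map_idI subset_iff)
  have "?g (fint T f as) = fint S f (map ?g as)"
    if "f \<in> Funs L" "length as = funar L f" "set as \<subseteq> univ T" for f as
  proof -
    have "h (fint S f (map ?g as)) = fint T f as"
      using h that g[OF that(3)] unfolding isomorphism_def by (metis length_map)
    moreover have "fint S f (map ?g as) \<in> univ S"
      using S that g[OF that(3)] unfolding is_struct_def by (metis length_map)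
    ultimately show ?thesis using bij by (metis bij_betw_inv_into_left)
  qed
  moreover have "rint T r as = rint S r (map ?g as)"
    if "r \<in> Rels L" "length as = relar L r" "set as \<subseteq> univ T" for r as
    using h that g[OF that(3)] unfolding isomorphism_def by (metis length_map)
  ultimately show ?thesis
    using bij by (simp add: isomorphism_def bij_betw_inv_into)
qed

lemma isomorphism_acl_subset:
  assumes S: "is_struct L S" and h: "isomorphism L S T h" and A: "A \<subseteq> univ S"
  shows "h ` acl L S A \<subseteq> acl L T (h ` A)"
proof
  fix a' assume "a' \<in> h ` acl L S A"
  then obtain a \<phi> x e where a: "a' = h a" "a \<in> univ S" and \<phi>: "\<phi> \<in> formulas L"
    and e: "e ` (FV \<phi> - {x}) \<subseteq> A" "sat S (e(x := a)) \<phi>"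
    and fin: "finite {d \<in> univ S. sat S (e(x := d)) \<phi>}"
    unfolding acl_def by blast
  have T: "univ T = h ` univ S" using h by (simp add: isomorphism_def bij_betw_def)
  have sat: "sat S (e(x := d)) \<phi> \<longleftrightarrow> sat T ((h \<circ> e)(x := h d)) \<phi>" if "d \<in> univ S" for d
  proof -
    have "sat S (e(x := d)) \<phi> \<longleftrightarrow> sat T (h \<circ> (e(x := d))) \<phi>"
      by (rule isomorphism_sat[OF S h]) (use \<phi> e(1) A that in \<open>auto simp: formulas_def\<close>)
    then show ?thesis by (simp only: fun_upd_comp)
  qed
  then have "{d \<in> univ T. sat T ((h \<circ> e)(x := d)) \<phi>} = h ` {d \<in> univ S. sat S (e(x := d)) \<phi>}"
    unfolding T by blast
  then have "finite {d \<in> univ T. sat T ((h \<circ> e)(x := d)) \<phi>}" using fin by simp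
  moreover have "sat T ((h \<circ> e)(x := a')) \<phi>" "a' \<in> univ T" using a e(2) sat[OF a(2)] T by simp_all
  moreover have "(h \<circ> e) ` (FV \<phi> - {x}) \<subseteq> h ` A" using e(1) by auto
  ultimately show "a' \<in> acl L T (h ` A)" by (intro aclI[OF \<phi>])
qed

lemma isomorphism_acl:
  assumes S: "is_struct L S" and T: "is_struct L T" and h: "isomorphism L S T h"
    and A: "A \<subseteq> univ S"
  shows "h ` acl L S A = acl L T (h ` A)"
proof
  show "h ` acl L S A \<subseteq> acl L T (h ` A)" by (rule isomorphism_acl_subset[OF S h A])
  let ?g = "inv_into (univ S) h"
  have bij: "bij_betw h (univ S) (univ T)" using h by (simp add: isomorphism_def)
  have "?g ` h ` A = A" using bij A by (auto simp: bij_betw_def)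
  moreover have "h ` A \<subseteq> univ T" using bij A by (auto simp: bij_betw_def)
  ultimately have g: "?g ` acl L T (h ` A) \<subseteq> acl L S A"
    using isomorphism_acl_subset[OF T isomorphism_inv[OF S h], of "h ` A"] by simp
  show "acl L T (h ` A) \<subseteq> h ` acl L S A"
  proof
    fix a assume a: "a \<in> acl L T (h ` A)"
    then have "h (?g a) = a" using bij by (auto simp: acl_def bij_betw_inv_into_right)
    then show "a \<in> h ` acl L S A" using g a by (metis image_eqI image_subset_iff)
  qed
qed

lemma isomorphism_component_map:
  assumes MN1: "elementary_extension L M N1" and MN2: "elementary_extension L M N2"
    and f: "isomorphism L N1 N2 f" and fix_M: "\<forall>a\<in>univ M. f a = a"
  shows "component_map L M N1 N2 f"
proof -
  have N: "is_struct L N1" "is_struct L N2" "univ M \<subseteq> univ N1"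
    using MN1 MN2 by (auto simp: elementary_extension_def)
  have bij: "bij_betw f (univ N1) (univ N2)" using f by (simp add: isomorphism_def)
  have "elementary_on L N1 N2 (acl_over L M N1 {b}) f
      \<and> f ` acl_over L M N1 {b} = acl_over L M N2 {f b}"
    if b: "b \<in> univ N1" for b
  proof
    have sub: "acl_over L M N1 {b} \<subseteq> univ N1" by (auto simp: acl_over_def acl_def)
    then show "elementary_on L N1 N2 (acl_over L M N1 {b}) f"
      by (rule isomorphism_elementary_on[OF N(1) f])
    have "f ` (univ M \<union> {b}) = univ M \<union> {f b}" using fix_M by auto
    then show "f ` acl_over L M N1 {b} = acl_over L M N2 {f b}"
      using isomorphism_acl[OF N(1,2) f, of "univ M \<union> {b}"] b N(3) by (simp add: acl_over_def)
  qed
  then show ?thesis using bij fix_M by (simp add: component_map_def)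
qed

theorem proposition4p4:
  fixes L :: "('f, 'r) language"
    and M N1 N2 :: "('f, 'r, 'a) struct"
  assumes "infinite (univ M)"
    and "mutually_algebraic_struct L M"
    and "elementary_extension L M N1"
    and "elementary_extension L M N2"
  shows "(\<forall>f. component_map L M N1 N2 f \<longrightarrow> isomorphism L N1 N2 f) \<and>
         (\<forall>f. isomorphism L N1 N2 f \<and> (\<forall>a\<in>univ M. f a = a) \<longrightarrow> component_map L M N1 N2 f)"
  using component_map_isomorphism[OF assms(2-4)] isomorphism_component_map[OF assms(3,4)] by blast

end
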